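(* Let $\mathcal H$ be a Hilbert lattice and let $A$ be a positive operator on $\mathcal H$ which is idempotent, i.e. $A^2=A$. Suppose that the self-commutator $C=A^*A-AA^*$ is also a positive operator. Then $A$ is an orthogonal projection, and so $C=0$.
   Context: A Hilbert lattice is a (real) Banach lattice whose norm is induced by an inner product; $A^*$ denotes the Hilbert space adjoint of the bounded operator $A$. An operator on a vector lattice is called positive if it maps the positive cone into itself (this is not positive semi-definiteness). *)

theory Defs
  imports "HOL-Analysis.Analysis" "HOL-Library.Lattice_Algebras"
begin

text \<open>
  The class \<^class>\<open>real_inner\<close> contains the requirement that the norm is induced by the
  inner product, and \<^class>\<open>lattice_ab_group_add_abs\<close> fixes the modulus of \<open>x\<close> as the
  supremum of \<open>x\<close> and \<open>- x\<close>. The order is partial, not necessarily linear.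
\<close>

class banach_lattice = banach + ordered_real_vector + lattice_ab_group_add_abs +
  assumes norm_mono_abs: "\<bar>x\<bar> \<le> \<bar>y\<bar> \<Longrightarrow> norm x \<le> norm y"

class hilbert_lattice = banach_lattice + real_inner

text \<open>Euclidean spaces with the componentwise order are Hilbert lattices.\<close>

instance ordered_euclidean_space \<subseteq> hilbert_lattice
proof
  fix x y :: 'a
  show "\<bar>x\<bar> = sup x (- x)"
    by (rule euclidean_eqI) (simp add: inner_Basis_sup_left abs_inner sup_max abs_real_def max_def)
  assume "\<bar>x\<bar> \<le> \<bar>y\<bar>"
  then have "\<bar>x \<bullet> i\<bar> \<le> \<bar>y \<bullet> i\<bar>" if "i \<in> Basis" for i
    using that by (simp add: eucl_le[of "\<bar>x\<bar>"] abs_inner)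
  then show "norm x \<le> norm y"
    by (rule norm_le_componentwise)
qed

definition positive_operator :: "('a::{ordered_real_vector, lattice} \<Rightarrow> 'a) \<Rightarrow> bool"
  where "positive_operator A \<longleftrightarrow> (\<forall>x\<ge>0. 0 \<le> A x)"

text \<open>
  The library constant \<^const>\<open>adjoint\<close> is a choice over the functions satisfying the defining
  identity of the adjoint; for a bounded linear operator on a complete real inner product space
  such a function exists by the Riesz representation theorem, and it is unique.
\<close>

definition self_commutator :: "('a::real_inner \<Rightarrow> 'a) \<Rightarrow> 'a \<Rightarrow> 'a"
  where "self_commutator A = (\<lambda>x. adjoint A (A x) - A (adjoint A x))"

definition orthogonal_projection :: "('a::real_inner \<Rightarrow> 'a) \<Rightarrow> bool"
  where "orthogonal_projection P \<longleftrightarrow>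
    (\<exists>M. closed M \<and> subspace M \<and> (\<forall>x. P x \<in> M \<and> (\<forall>y\<in>M. orthogonal (x - P x) y)))"

text \<open>For bounded operators this agrees with the description \<open>P\<^sup>2 = P = P\<^sup>*\<close>.\<close>

lemma orthogonal_projection_iff:
  fixes P :: "'a::real_inner \<Rightarrow> 'a"
  assumes "bounded_linear P"
  shows "orthogonal_projection P \<longleftrightarrow> P \<circ> P = P \<and> (\<forall>x y. P x \<bullet> y = x \<bullet> P y)"
proof
  assume "orthogonal_projection P"
  then obtain M where M: "subspace M" "\<And>x. P x \<in> M" "\<And>x y. y \<in> M \<Longrightarrow> (x - P x) \<bullet> y = 0"
    unfolding orthogonal_projection_def orthogonal_def by blast
  have fixed: "P x = x" if "x \<in> M" for x
    using M(3)[of "x - P x" x] M(1,2) that by (simp add: subspace_diff)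
  have "P x \<bullet> y = x \<bullet> P y" for x y
    using M(3)[of "P y" x] M(3)[of "P x" y] M(2)
    by (simp add: inner_diff_left inner_commute[of y] inner_commute[of "P y"])
  with fixed M(2) show "P \<circ> P = P \<and> (\<forall>x y. P x \<bullet> y = x \<bullet> P y)" by auto
next
  interpret bounded_linear P by fact
  assume asm: "P \<circ> P = P \<and> (\<forall>x y. P x \<bullet> y = x \<bullet> P y)"
  then have idem: "P (P x) = P x" for x by (metis comp_apply)
  have "closed {x. P x = x}"
    by (intro closed_Collect_eq continuous_on continuous_intros)
  moreover have "subspace {x. P x = x}"
    by (simp add: subspace_def zero add scaleR)
  moreover have "P x \<in> {x. P x = x} \<and> (\<forall>y\<in>{x. P x = x}. orthogonal (x - P x) y)" for x
    using asm idem by (auto simp: orthogonal_def inner_diff_left)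
  ultimately show "orthogonal_projection P"
    unfolding orthogonal_projection_def by blast
qed

end

theory Submission
  imports Defs
begin

text \<open>
  For a vector \<open>x \<ge> 0\<close> also \<open>A x \<ge> 0\<close>, and the inner product of two positive vectors is nonnegative.
  So positivity of \<open>C = A\<^sup>*A - AA\<^sup>*\<close> gives \<open>0 \<le> \<langle>C A x, A x\<rangle>\<close>. Because \<open>A\<close> is idempotent, the
  right-hand side is \<open>\<parallel>A x\<parallel>\<^sup>2 - \<parallel>A\<^sup>*A x\<parallel>\<^sup>2\<close>, and therefore
  \<open>\<parallel>A x\<parallel>\<^sup>2 = \<langle>A\<^sup>*A x, x\<rangle> \<le> \<parallel>A\<^sup>*A x\<parallel> \<parallel>x\<parallel> \<le> \<parallel>A x\<parallel> \<parallel>x\<parallel>\<close>,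
  that is, \<open>A\<close> is contractive on the positive cone. By \<open>\<bar>A x\<bar> \<le> A \<bar>x\<bar>\<close> and monotonicity of the
  norm it is contractive everywhere, and a contractive idempotent on an inner product space is
  self-adjoint (\<open>contractive_idempotent_self_adjoint\<close>).

  The only analytic ingredient is the existence of the adjoint, which rests on the Riesz
  representation theorem (\<open>riesz_representation\<close>).
\<close>

section \<open>The Riesz representation theorem and adjoints\<close>

text \<open>
  The first-order condition in all minimisation arguments below: a quadratic polynomial with a
  minimum at \<open>0\<close> has no linear term.
\<close>

lemma linear_term_zero_if_quadratic_nonneg:
  fixes a b :: real
  assumes "\<And>t. 0 \<le> t * a + t\<^sup>2 * b"
  shows "a = 0"
proof -
  define c where "c = \<bar>b\<bar> + 1"
  have c: "c > 0" "b - c < 0" by (auto simp: c_def)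
  have "0 \<le> (- a / c) * a + (- a / c)\<^sup>2 * b" by (rule assms)
  also have "\<dots> = a\<^sup>2 * (b - c) / c\<^sup>2"
    using c by (simp add: field_simps power2_eq_square)
  finally have "0 \<le> a\<^sup>2 * (b - c)"
    using c by (simp add: zero_le_divide_iff)
  then have "a\<^sup>2 \<le> 0"
    using c(2) by (simp add: zero_le_mult_iff)
  then show ?thesis by simp
qed

lemma norm_add_scaleR_squared:
  fixes x y :: "'a::real_inner"
  shows "(norm (x + t *\<^sub>R y))\<^sup>2 = (norm x)\<^sup>2 + 2 * t * (x \<bullet> y) + t\<^sup>2 * (norm y)\<^sup>2"
  unfolding power2_norm_eq_inner
  by (simp add: inner_add_left inner_add_right inner_commute power2_eq_square)

text \<open>
  The representing vector is the minimiser of the energy \<open>\<parallel>x\<parallel>\<^sup>2 / 2 - f x\<close>. By the parallelogram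
  law the energy is uniformly convex, so minimising sequences are Cauchy.
\<close>

lemma riesz_representation:
  fixes f :: "'a::{banach, real_inner} \<Rightarrow> real"
  assumes "bounded_linear f"
  obtains w where "\<And>x. f x = w \<bullet> x"
proof -
  interpret bounded_linear f by fact
  define Q where "Q x = (norm x)\<^sup>2 / 2 - f x" for x
  obtain K where K: "\<And>x. norm (f x) \<le> norm x * K"
    using bounded by blast
  have "- K\<^sup>2 / 2 \<le> Q x" for x
  proof -
    have "0 \<le> (norm x - K)\<^sup>2" by simp
    also have "\<dots> = (norm x)\<^sup>2 - 2 * (norm x * K) + K\<^sup>2"
      by (simp add: power2_eq_square algebra_simps)
    finally show ?thesis
      using K[of x] by (simp add: Q_def)
  qed
  then have bdd: "bdd_below (range Q)" by (auto intro!: bdd_belowI)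
  define m where "m = Inf (range Q)"
  have m_le: "m \<le> Q x" for x
    unfolding m_def by (rule cInf_lower) (auto simp: bdd)
  have "\<exists>x. Q x < m + inverse (Suc n)" for n
  proof -
    have "Inf (range Q) < m + inverse (Suc n)" by (simp add: m_def)
    from cInf_lessD[OF _ this] show ?thesis by auto
  qed
  then obtain X where X: "\<And>n. Q (X n) < m + inverse (Suc n)" by metis
  have convex: "(norm (x - y))\<^sup>2 \<le> 4 * (Q x - m) + 4 * (Q y - m)" for x y
  proof -
    have "(norm (x + y))\<^sup>2 = 2 * (norm x)\<^sup>2 + 2 * (norm y)\<^sup>2 - (norm (x - y))\<^sup>2"
      using norm_add_scaleR_squared[of x 1 y] norm_add_scaleR_squared[of x "-1" y] by simp
    moreover have "Q ((1/2) *\<^sub>R (x + y)) = (norm (x + y))\<^sup>2 / 8 - (f x + f y) / 2"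
      unfolding Q_def scaleR add norm_scaleR power_mult_distrib
      by (simp add: power2_eq_square)
    ultimately have "8 * Q ((1/2) *\<^sub>R (x + y)) = 4 * Q x + 4 * Q y - (norm (x - y))\<^sup>2"
      using Q_def[of x] Q_def[of y] by (simp only:) argo
    with m_le[of "(1/2) *\<^sub>R (x + y)"] show ?thesis by simp
  qed
  have "Cauchy X"
  proof (rule CauchyI)
    fix e :: real
    assume e: "0 < e"
    then obtain N where N: "inverse (real (Suc N)) < e\<^sup>2 / 8"
      using reals_Archimedean[of "e\<^sup>2 / 8"] by auto
    have near: "Q (X i) - m < e\<^sup>2 / 8" if "N \<le> i" for i
    proof -
      have "inverse (real (Suc i)) \<le> inverse (real (Suc N))"
        using that by (simp add: le_imp_inverse_le)
      with X[of i] N show ?thesis by linarith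
    qed
    have "norm (X i - X j) < e" if "N \<le> i" "N \<le> j" for i j
    proof (rule power2_less_imp_less)
      show "(norm (X i - X j))\<^sup>2 < e\<^sup>2"
        using convex[of "X i" "X j"] near[OF that(1)] near[OF that(2)] by argo
    qed (use e in simp)
    then show "\<exists>N. \<forall>i\<ge>N. \<forall>j\<ge>N. norm (X i - X j) < e" by blast
  qed
  then obtain w where w: "X \<longlonglongrightarrow> w"
    using Cauchy_convergent_iff convergent_def by blast
  have "(\<lambda>n. Q (X n)) \<longlonglongrightarrow> Q w"
    unfolding Q_def by (intro tendsto_intros tendsto w) simp
  moreover have "(\<lambda>n. m + inverse (Suc n)) \<longlonglongrightarrow> m + 0"
    by (intro tendsto_add tendsto_const LIMSEQ_inverse_real_of_nat)
  ultimately have "Q w \<le> m + 0"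
    by (rule LIMSEQ_le) (use X less_imp_le in blast)
  with m_le have min: "Q w \<le> Q x" for x
    by (metis add.right_neutral order_trans)
  have "f x = w \<bullet> x" for x
  proof -
    have "w \<bullet> x - f x = 0"
    proof (rule linear_term_zero_if_quadratic_nonneg)
      fix t :: real
      show "0 \<le> t * (w \<bullet> x - f x) + t\<^sup>2 * ((norm x)\<^sup>2 / 2)"
        using min[of "w + t *\<^sub>R x"]
        by (simp add: Q_def add scaleR norm_add_scaleR_squared field_simps)
    qed
    then show ?thesis by simp
  qed
  then show thesis by (rule that)
qed

lemma bounded_linear_adjoint_works:
  fixes A :: "'a::{banach, real_inner} \<Rightarrow> 'b::real_inner"
  assumes "bounded_linear A"
  shows "A x \<bullet> y = x \<bullet> adjoint A y"
proof -
  have "\<exists>w. \<forall>x. A x \<bullet> y = x \<bullet> w" for y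
  proof -
    have "bounded_linear (\<lambda>x. A x \<bullet> y)"
      by (rule bounded_linear_compose[OF bounded_linear_inner_left assms])
    then show ?thesis
      by (metis riesz_representation inner_commute)
  qed
  then obtain B where "\<forall>x y. A x \<bullet> y = x \<bullet> B y" by metis
  then show ?thesis
    using adjoint_unique by blast
qed

section \<open>Contractive idempotents\<close>

text \<open>
  If \<open>k\<close> lies in the kernel and \<open>r\<close> in the range, then \<open>r = A (r + t k)\<close>, so by contractivity \<open>r\<close>
  is the shortest vector on the line \<open>r + t k\<close>. Hence kernel and range are orthogonal.
\<close>

lemma contractive_idempotent_self_adjoint:
  fixes A :: "'a::real_inner \<Rightarrow> 'a"
  assumes "linear A" and idem: "\<And>x. A (A x) = A x" and contr: "\<And>x. norm (A x) \<le> norm x"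
  shows "A x \<bullet> y = x \<bullet> A y"
proof -
  interpret linear A by fact
  have orth: "A u \<bullet> (v - A v) = 0" for u v
  proof -
    have "2 * (A u \<bullet> (v - A v)) = 0"
    proof (rule linear_term_zero_if_quadratic_nonneg)
      fix t :: real
      have "A (A u + t *\<^sub>R (v - A v)) = A u"
        by (simp add: add scale diff idem)
      then have "norm (A u) \<le> norm (A u + t *\<^sub>R (v - A v))"
        by (metis contr)
      then have "(norm (A u))\<^sup>2 \<le> (norm (A u + t *\<^sub>R (v - A v)))\<^sup>2"
        by (simp add: power_mono)
      then show "0 \<le> t * (2 * (A u \<bullet> (v - A v))) + t\<^sup>2 * (norm (v - A v))\<^sup>2"
        unfolding norm_add_scaleR_squared by (simp add: mult_ac)
    qed
    then show ?thesis by simp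
  qed
  have "A x \<bullet> y = A x \<bullet> A y"
    using orth[of x y] by (simp add: inner_diff_right)
  also have "\<dots> = x \<bullet> A y"
    using orth[of y x] by (simp add: inner_diff_right inner_commute)
  finally show ?thesis .
qed

section \<open>Positivity in Hilbert lattices\<close>

text \<open>
  By polarisation \<open>4 \<langle>x, y\<rangle> = \<parallel>x + y\<parallel>\<^sup>2 - \<parallel>x - y\<parallel>\<^sup>2\<close>, and \<open>\<bar>x - y\<bar> \<le> x + y\<close> for positive \<open>x\<close>, \<open>y\<close>.
\<close>

lemma inner_nonneg_of_nonneg:
  fixes x y :: "'a::hilbert_lattice"
  assumes "0 \<le> x" "0 \<le> y"
  shows "0 \<le> x \<bullet> y"
proof -
  have "x - y \<le> x + y" "- (x - y) \<le> x + y"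
    using assms by (simp_all add: algebra_simps add_increasing add_increasing2)
  then have "\<bar>x - y\<bar> \<le> x + y"
    by (rule abs_leI)
  also have "\<dots> = \<bar>x + y\<bar>"
    using assms by simp
  finally have "norm (x - y) \<le> norm (x + y)"
    by (rule norm_mono_abs)
  then have "(norm (x - y))\<^sup>2 \<le> (norm (x + y))\<^sup>2"
    by (simp add: power_mono)
  then show ?thesis
    by (simp add: power2_norm_eq_inner inner_add_left inner_add_right inner_diff_left
        inner_diff_right inner_commute)
qed

lemma norm_abs_lattice:
  fixes x :: "'a::banach_lattice"
  shows "norm \<bar>x\<bar> = norm x"
  by (rule antisym) (simp_all add: norm_mono_abs)

lemma positive_operator_contractive_if_on_cone:
  fixes A :: "'a::banach_lattice \<Rightarrow> 'a"
  assumes "linear A" "positive_operator A" and cone: "\<And>x. 0 \<le> x \<Longrightarrow> norm (A x) \<le> norm x"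
  shows "norm (A x) \<le> norm x"
proof -
  interpret linear A by fact
  have mono: "A u \<le> A v" if "u \<le> v" for u v
    using assms(2) that unfolding positive_operator_def
    by (metis diff diff_ge_0_iff_ge)
  have "A x \<le> A \<bar>x\<bar>" "- A x \<le> A \<bar>x\<bar>"
    using mono[of x "\<bar>x\<bar>"] mono[of "- x" "\<bar>x\<bar>"] by (simp_all add: abs_ge_self abs_ge_minus_self neg)
  then have "\<bar>A x\<bar> \<le> A \<bar>x\<bar>"
    by (rule abs_leI)
  also have "\<dots> \<le> \<bar>A \<bar>x\<bar>\<bar>"
    by (rule abs_ge_self)
  finally have "norm (A x) \<le> norm (A \<bar>x\<bar>)"
    by (rule norm_mono_abs)
  also have "\<dots> \<le> norm \<bar>x\<bar>"
    by (rule cone) simp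
  finally show ?thesis
    by (simp add: norm_abs_lattice)
qed

section \<open>Positive idempotents with positive self-commutator\<close>

theorem proposition2p1:
  fixes A :: "'h::hilbert_lattice \<Rightarrow> 'h"
  assumes "bounded_linear A"
    and "positive_operator A"
    and "A \<circ> A = A"
    and "positive_operator (self_commutator A)"
  shows "orthogonal_projection A \<and> self_commutator A = (\<lambda>x. 0)"
proof -
  have lin: "linear A"
    using assms(1) by (rule bounded_linear.linear)
  have idem: "A (A x) = A x" for x
    using assms(3) by (metis comp_apply)
  note adj = bounded_linear_adjoint_works[OF assms(1)]
  have "norm (A x) \<le> norm x" if "0 \<le> x" for x
  proof -
    let ?b = "adjoint A (A x)"
    have Ax: "0 \<le> A x"
      using assms(2) that by (simp add: positive_operator_def)
    with assms(4) have "0 \<le> A x \<bullet> self_commutator A (A x)"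
      by (simp add: positive_operator_def inner_nonneg_of_nonneg)
    also have "\<dots> = A x \<bullet> A x - ?b \<bullet> ?b"
      using adj[of "A x" "A x"] adj[of ?b "A x"]
      by (simp add: self_commutator_def inner_diff_right idem inner_commute)
    finally have "norm ?b \<le> norm (A x)"
      by (simp add: norm_le)
    have "norm (A x) * norm (A x) = x \<bullet> ?b"
      using adj[of x "A x"] by (simp flip: power2_norm_eq_inner add: power2_eq_square)
    also have "\<dots> \<le> norm x * norm ?b"
      by (rule norm_cauchy_schwarz)
    also have "\<dots> \<le> norm x * norm (A x)"
      using \<open>norm ?b \<le> norm (A x)\<close> by (simp add: mult_left_mono)
    finally show ?thesis
      by (cases "A x = 0") simp_all
  qed
  then have "norm (A x) \<le> norm x" for x
    by (rule positive_operator_contractive_if_on_cone[OF lin assms(2)])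
  then have sa: "A x \<bullet> y = x \<bullet> A y" for x y
    by (rule contractive_idempotent_self_adjoint[OF lin idem])
  then have "orthogonal_projection A"
    using orthogonal_projection_iff[OF assms(1)] assms(3) by blast
  moreover have "adjoint A = A"
    using sa by (intro adjoint_unique) blast
  then have "self_commutator A = (\<lambda>x. 0)"
    by (simp add: self_commutator_def)
  ultimately show ?thesis ..
qed

end
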